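(* Let $q$ be an odd prime, $d\ge1$, $Y:=\mathbb{F}_q^d\setminus\{0\}$, $E\subseteq\mathbb{F}_q^d$ with $1<\sharp E<q^d$, $E^*:=E\setminus\{0\}$, $\mathcal{A}\subseteq\mathrm{Aut}(\mathbb{F}_q^d)$ and $L\subseteq\mathbb{F}_q^d$. Let $\psi:=(\sharp E)^{-1/2}\,\check{1_{E^*}}$ and $\mathcal{W}:=\{\delta_a\tau_l\psi: a\in\mathcal{A},\ l\in L\}$. If $\mathcal{W}$ is an orthogonal basis for $PW_Y$ and $0\in L$, then the sets $a^t(E^* )$, $a\in\mathcal{A}$, are mutually disjoint and $(E^*,L)$ is a spectral pair.
   Context: $\mathbb{F}_q$ is the field with $q$ elements; $\mathrm{Aut}(\mathbb{F}_q^d)$ is the set of automorphisms of $\mathbb{F}_q^d$, identified with invertible $d\times d$ matrices; $a^t$ is the transpose of $a$. For $m,x\in\mathbb{F}_q^d$, $\chi_m(x)=e^{2\pi i\, m\cdot x/q}$. Fourier transform: $\hat f(\xi)=q^{-d}\sum_{m} f(m)\overline{\chi_m(\xi)}$; inverse: $\check g(x)=\sum_{m} g(m)\chi_m(x)$. The inner product on the space $L^2(\mathbb{F}_q^d)$ on which wavelet systems live is $\langle f,g\rangle=q^{-d}\sum_x f(x)\overline{g(x)}$, while on the Fourier side (and on $L^2(F)$, $F\subseteq\mathbb{F}_q^d$) it is $\sum_m f(m)\overline{g(m)}$; thus $f\mapsto\hat f$ is unitary. $\delta_a\psi(x)=\psi(ax)$, $\tau_t\psi(x)=\psi(x-t)$,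 so $\delta_a\tau_t\psi(x)=\psi(ax-t)$. $PW_Y=\{f\in L^2(\mathbb{F}_q^d): \hat f(m)=0\ \text{for all } m\notin Y\}$. $(F,L)$ is a spectral pair if $\{\chi_l\}_{l\in L}$, restricted to $F$, is an orthogonal basis of $L^2(F)$ (equivalently, $\{(\sharp F)^{-1/2}\chi_l\}_{l\in L}$ is an orthonormal basis of $L^2(F)$ for counting measure). The family $\mathcal{W}$ is indexed by pairs $(a,l)$. *)

theory Defs
  imports
    "HOL-Analysis.Analysis"
    "HOL-Library.Function_Algebras"
    "HOL-Library.Disjoint_Sets"
    "Berlekamp_Zassenhaus.Finite_Field"
begin

text \<open>
  The field with \<open>q = CARD('q)\<close> elements is \<open>'q mod_ring\<close>; the class \<open>prime_card\<close> says that
  \<open>CARD('q)\<close> is prime. Automorphisms of the space of column vectors are invertible matrices,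
  acting by \<^const>\<open>matrix_vector_mult\<close>.
\<close>

type_synonym ('q, 'd) space = "'q mod_ring ^ 'd"

definition fscale :: "complex \<Rightarrow> ('v \<Rightarrow> complex) \<Rightarrow> 'v \<Rightarrow> complex" where
  "fscale c f = (\<lambda>x. c * f x)"

global_interpretation cfun: vector_space "fscale :: complex \<Rightarrow> ('v \<Rightarrow> complex) \<Rightarrow> 'v \<Rightarrow> complex"
  by unfold_locales (simp_all add: fscale_def fun_eq_iff algebra_simps)

text \<open>
  The basis is the indexed family \<open>v\<close> on \<open>I\<close>: distinct indices give distinct, orthogonal
  elements.
\<close>

definition orthogonal_basis ::
  "(('v \<Rightarrow> complex) \<Rightarrow> ('v \<Rightarrow> complex) \<Rightarrow> complex) \<Rightarrow> 'i set \<Rightarrow> ('i \<Rightarrow> 'v \<Rightarrow> complex)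
    \<Rightarrow> ('v \<Rightarrow> complex) set \<Rightarrow> bool" where
  "orthogonal_basis ip I v V \<longleftrightarrow>
     inj_on v I \<and> cfun.independent (v ` I) \<and> cfun.span (v ` I) = V \<and>
     (\<forall>i\<in>I. \<forall>j\<in>I. i \<noteq> j \<longrightarrow> ip (v i) (v j) = 0)"

text \<open>
  Wavelet systems live on the side with normalised counting measure; the Fourier side and
  \<open>L2_on F\<close> carry plain counting measure (\<open>ip_on\<close> below).
\<close>

definition ip_space ::
  "(('q::prime_card, 'd::finite) space \<Rightarrow> complex) \<Rightarrow> (('q, 'd) space \<Rightarrow> complex) \<Rightarrow> complex" where
  "ip_space f g = (\<Sum>x\<in>UNIV. f x * cnj (g x)) / of_nat (CARD('q) ^ CARD('d))"

text \<open>
  Functions on a subset \<open>F\<close> are represented by their extension by zero.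
\<close>

definition L2_on :: "'v set \<Rightarrow> ('v \<Rightarrow> complex) set" where
  "L2_on F = {f. \<forall>x. x \<notin> F \<longrightarrow> f x = 0}"

definition restrict0 :: "'v set \<Rightarrow> ('v \<Rightarrow> complex) \<Rightarrow> 'v \<Rightarrow> complex" where
  "restrict0 F f = (\<lambda>x. if x \<in> F then f x else 0)"

definition ip_on :: "'v set \<Rightarrow> ('v \<Rightarrow> complex) \<Rightarrow> ('v \<Rightarrow> complex) \<Rightarrow> complex" where
  "ip_on F f g = (\<Sum>x\<in>F. f x * cnj (g x))"

definition character :: "('q::prime_card, 'd::finite) space \<Rightarrow> ('q, 'd) space \<Rightarrow> complex" where
  "character m x =
     exp (2 * of_real pi * \<i> * of_int (to_int_mod_ring (scalar_product m x)) / of_nat CARD('q))"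

definition fourier ::
  "(('q::prime_card, 'd::finite) space \<Rightarrow> complex) \<Rightarrow> ('q, 'd) space \<Rightarrow> complex" where
  "fourier f \<xi> = (\<Sum>m\<in>UNIV. f m * cnj (character m \<xi>)) / of_nat (CARD('q) ^ CARD('d))"

definition inv_fourier ::
  "(('q::prime_card, 'd::finite) space \<Rightarrow> complex) \<Rightarrow> ('q, 'd) space \<Rightarrow> complex" where
  "inv_fourier g x = (\<Sum>m\<in>UNIV. g m * character m x)"

definition PW :: "('q::prime_card, 'd::finite) space set \<Rightarrow> (('q, 'd) space \<Rightarrow> complex) set" where
  "PW Y = {f. \<forall>m. m \<notin> Y \<longrightarrow> fourier f m = 0}"

definition dilation ::
  "'q::prime_card mod_ring ^ 'd ^ 'd \<Rightarrow> (('q, 'd::finite) space \<Rightarrow> complex)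
    \<Rightarrow> ('q, 'd) space \<Rightarrow> complex" where
  "dilation a f = (\<lambda>x. f (a *v x))"

definition translation ::
  "('q::prime_card, 'd::finite) space \<Rightarrow> (('q, 'd) space \<Rightarrow> complex)
    \<Rightarrow> ('q, 'd) space \<Rightarrow> complex" where
  "translation t f = (\<lambda>x. f (x - t))"

definition spectral_pair ::
  "('q::prime_card, 'd::finite) space set \<Rightarrow> ('q, 'd) space set \<Rightarrow> bool" where
  "spectral_pair F L \<longleftrightarrow>
     orthogonal_basis (ip_on F) L (\<lambda>l. restrict0 F (character l)) (L2_on F)"

text \<open>
  The factor is \<open>(card E)\<^sup>-\<^sup>1\<^sup>/\<^sup>2\<close> even when \<open>0 \<in> E\<close>, so the generator need not be normalised.
\<close>

definition wavelet_gen ::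
  "('q::prime_card, 'd::finite) space set \<Rightarrow> ('q, 'd) space \<Rightarrow> complex" where
  "wavelet_gen E =
     fscale (of_real (real (card E) powr (- 1 / 2))) (inv_fourier (indicator (E - {0})))"

definition wavelet_family ::
  "(('q::prime_card, 'd::finite) space \<Rightarrow> complex)
    \<Rightarrow> ('q mod_ring ^ 'd ^ 'd) \<times> ('q, 'd) space \<Rightarrow> ('q, 'd) space \<Rightarrow> complex" where
  "wavelet_family \<psi> = (\<lambda>(a, l). dilation a (translation l \<psi>))"

end

theory Submission
  imports Defs
begin

text \<open>
  The idea is to read the wavelet system on the Fourier side. By the translation and dilation rules,
  the transform of \<open>\<delta>\<^sub>a \<tau>\<^sub>l \<psi>\<close> is supported on \<open>a\<^sup>t(E\<^sup>*)\<close>, and pulled back to \<open>E\<^sup>*\<close> along \<open>a\<^sup>t\<close> it is the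
  complex conjugate of the character \<open>\<chi>\<^sub>l\<close>, up to the positive constant of the generator
  (\<open>fourier_wavelet\<close>). Parseval's identity then converts the orthogonality hypothesis into statements
  about these pieces.

  For \<open>a \<noteq> b\<close> the members with \<open>l = 0\<close> (this is where \<open>0 \<in> L\<close> enters) have transforms that are positive
  multiples of the indicators of \<open>a\<^sup>t(E\<^sup>*)\<close> and \<open>b\<^sup>t(E\<^sup>*)\<close>, so their inner product counts the
  intersection, which must be empty (\<open>disjoint_images_if_orthogonal\<close>). For a single \<open>a\<close>, the inner
  product of the members with parameters \<open>l\<close> and \<open>k\<close> is a multiple of that of \<open>\<chi>\<^sub>k\<close> and \<open>\<chi>\<^sub>l\<close> over \<open>E\<^sup>*\<close>,
  so distinct elements of \<open>L\<close> give orthogonal characters (\<open>characters_orthogonal\<close>).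

  For completeness, fix \<open>a\<close> and map \<open>f\<close> to the conjugate of its transform, pulled back along \<open>a\<^sup>t\<close> and
  cut down to \<open>E\<^sup>*\<close>. By the disjointness just obtained this conjugate-linear map annihilates the
  wavelets with any other matrix, and it sends those with matrix \<open>a\<close> to multiples of the \<open>\<chi>\<^sub>l\<close>, so
  it maps the Paley--Wiener space into the span of these characters
  (\<open>pulled_back_spectrum_in_span\<close>). As \<open>a\<^sup>t(E\<^sup>*)\<close> misses \<open>0\<close>, every function on \<open>E\<^sup>*\<close> is the image of a
  function in that space.
\<close>

section \<open>Characters\<close>

lemma cis_cong_mod:
  assumes "q > 0"
  shows "cis (2 * pi * of_int (n mod int q) / of_nat q) = cis (2 * pi * of_int n / of_nat q)"
proof -
  have "real_of_int n = of_int (n div int q * int q + n mod int q)"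
    by simp
  also have "\<dots> = of_int (n div int q) * of_nat q + of_int (n mod int q)"
    by (simp only: of_int_add of_int_mult of_int_of_nat_eq)
  finally have "2 * pi * of_int n / of_nat q =
      2 * pi * of_int (n div int q) + 2 * pi * of_int (n mod int q) / of_nat q"
    using assms by (simp add: field_simps)
  then show ?thesis
    by (simp flip: cis_mult add: cis_multiple_2pi)
qed

lemma character_cis:
  "character m (x :: ('q::prime_card, 'd::finite) space) =
     cis (2 * pi * of_int (to_int_mod_ring (scalar_product m x)) / of_nat CARD('q))"
  unfolding character_def cis_conv_exp by (simp add: mult_ac)

lemma character_commute: "character m x = character x m"
  by (simp add: character_def scalar_product_def mult.commute)

lemma character_add:
  fixes x y :: "('q::prime_card, 'd::finite) space"
  shows "character m (x + y) = character m x * character m y"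
proof -
  have "scalar_product m (x + y) = scalar_product m x + scalar_product m y"
    by (simp add: scalar_product_def ring_distribs sum.distrib)
  moreover have "to_int_mod_ring (s + t) =
      (to_int_mod_ring s + to_int_mod_ring t) mod int CARD('q)" for s t :: "'q mod_ring"
    by transfer simp
  ultimately show ?thesis
    unfolding character_cis cis_mult
    by (simp add: cis_cong_mod ring_distribs add_divide_distrib)
qed

lemma character_mult_cnj_self [simp]: "character m x * cnj (character m x) = 1"
  by (simp add: character_cis cis_cnj cis_mult)

lemma character_0 [simp]: "character m 0 = 1"
  using character_add[of m 0 0] character_mult_cnj_self[of m 0]
  by (metis add_0 mult_cancel_left1 mult_zero_left zero_neq_one)

lemma character_minus: "character m (- x) = cnj (character m x)"
proof -
  have "character m (- x) = character m (- x) * (character m x * cnj (character m x))"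
    by simp
  also have "\<dots> = character m (- x + x) * cnj (character m x)"
    by (simp only: character_add mult.assoc)
  finally show ?thesis by simp
qed

lemma character_diff: "character m (x - y) = character m x * cnj (character m y)"
  using character_add[of m x "- y"] by (simp add: character_minus)

text \<open>
  Along a coordinate axis where \<open>m\<close> has the nonzero entry \<open>k\<close>, the character takes the value
  \<open>exp (2 \<pi> \<i> k / q)\<close>, and the representative satisfies \<open>0 < k < q\<close>.
\<close>

lemma character_nontrivial:
  fixes m :: "('q::prime_card, 'd::finite) space"
  assumes "m \<noteq> 0"
  obtains x where "character m x \<noteq> 1"
proof -
  obtain i where i: "m $ i \<noteq> 0"
    using assms by (auto simp: vec_eq_iff)
  define k where "k = to_int_mod_ring (m $ i)"
  have k: "0 \<le> k" "k < int CARD('q)"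
    using range_to_int_mod_ring[where 'a='q] by (auto simp: k_def)
  have "k \<noteq> 0"
    using i by (simp add: k_def)
  have "scalar_product m (axis i 1) = m $ i"
    by (simp add: scalar_product_def axis_def if_distrib cong: if_cong)
  then have char: "character m (axis i 1) = cis (2 * pi * of_int k / of_nat CARD('q))"
    by (simp add: character_cis k_def)
  have "character m (axis i 1) \<noteq> 1"
  proof
    assume "character m (axis i 1) = 1"
    then have "cos (2 * pi * of_int k / of_nat CARD('q)) = 1"
      unfolding char by (simp add: complex_eq_iff)
    then obtain n :: int where "2 * pi * of_int k / of_nat CARD('q) = of_int n * 2 * pi"
      by (metis cos_one_2pi_int)
    then have "real_of_int k = of_int n * of_nat CARD('q)"
      by (simp add: field_simps)
    then have "k = n * int CARD('q)"
      by (metis of_int_eq_iff of_int_mult of_int_of_nat_eq)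
    then have "int CARD('q) dvd k"
      by simp
    then show False
      using k \<open>k \<noteq> 0\<close> by (meson dvd_imp_le less_le not_le zdvd_not_zless)
  qed
  then show ?thesis ..
qed

text \<open>
  Shifting the summation variable multiplies the sum by any chosen value of the character, which can
  be taken different from \<open>1\<close>.
\<close>

lemma sum_character_eq_0:
  fixes m :: "('q::prime_card, 'd::finite) space"
  assumes "m \<noteq> 0"
  shows "(\<Sum>x\<in>UNIV. character m x) = 0"
proof -
  obtain y where y: "character m y \<noteq> 1"
    using character_nontrivial[OF assms] .
  have "(\<Sum>x\<in>UNIV. character m x) = (\<Sum>x\<in>UNIV. character m (y + x))"
    by (rule sum.reindex_bij_witness[of _ "\<lambda>x. y + x" "\<lambda>x. x - y"]) auto
  also have "\<dots> = character m y * (\<Sum>x\<in>UNIV. character m x)"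
    by (simp add: character_add sum_distrib_left)
  finally show ?thesis
    using y by (metis mult_cancel_right1)
qed

lemma sum_character_cnj_character:
  fixes m n :: "('q::prime_card, 'd::finite) space"
  shows "(\<Sum>x\<in>UNIV. character m x * cnj (character n x)) =
    (if m = n then of_nat (CARD('q) ^ CARD('d)) else 0)"
proof -
  have "character m x * cnj (character n x) = character (m - n) x" for x
    by (metis character_commute character_diff)
  then show ?thesis
    using sum_character_eq_0[of "m - n"] by (auto simp: character_commute[of 0])
qed

section \<open>The Fourier transform\<close>

lemma fourier_inv_fourier:
  fixes g :: "('q::prime_card, 'd::finite) space \<Rightarrow> complex"
  shows "fourier (inv_fourier g) \<xi> = g \<xi>"
proof -
  have "(\<Sum>x\<in>UNIV. inv_fourier g x * cnj (character x \<xi>)) =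
      (\<Sum>x\<in>UNIV. \<Sum>m\<in>UNIV. g m * (character m x * cnj (character \<xi> x)))"
    by (simp add: inv_fourier_def sum_distrib_left sum_distrib_right mult_ac
        character_commute[of _ \<xi>])
  also have "\<dots> = (\<Sum>m\<in>UNIV. g m * (\<Sum>x\<in>UNIV. character m x * cnj (character \<xi> x)))"
    by (subst sum.swap) (simp add: sum_distrib_left)
  also have "\<dots> = g \<xi> * of_nat (CARD('q) ^ CARD('d))"
    by (simp add: sum_character_cnj_character if_distrib cong: if_cong)
  finally show ?thesis
    by (simp add: fourier_def)
qed

lemma inv_fourier_fourier:
  fixes f :: "('q::prime_card, 'd::finite) space \<Rightarrow> complex"
  shows "inv_fourier (fourier f) x = f x"
proof -
  have "inv_fourier (fourier f) x =
      (\<Sum>m\<in>UNIV. \<Sum>y\<in>UNIV. f y * (character x m * cnj (character y m)))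
        / of_nat (CARD('q) ^ CARD('d))"
    by (simp add: inv_fourier_def fourier_def sum_distrib_left sum_distrib_right
        sum_divide_distrib mult_ac
        character_commute[of _ x])
  also have "(\<Sum>m\<in>UNIV. \<Sum>y\<in>UNIV. f y * (character x m * cnj (character y m))) =
      (\<Sum>y\<in>UNIV. f y * (\<Sum>m\<in>UNIV. character x m * cnj (character y m)))"
    by (subst sum.swap) (simp add: sum_distrib_left)
  also have "\<dots> = f x * of_nat (CARD('q) ^ CARD('d))"
    by (simp add: sum_character_cnj_character if_distrib cong: if_cong)
  finally show ?thesis
    by simp
qed

lemma parseval:
  fixes f g :: "('q::prime_card, 'd::finite) space \<Rightarrow> complex"
  shows "ip_space f g = (\<Sum>\<xi>\<in>UNIV. fourier f \<xi> * cnj (fourier g \<xi>))"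
proof -
  have "(\<Sum>x\<in>UNIV. f x * cnj (g x)) =
      (\<Sum>x\<in>UNIV. \<Sum>\<xi>\<in>UNIV. fourier f \<xi> * (character x \<xi> * cnj (g x)))"
  proof (rule sum.cong[OF refl])
    fix x
    have "f x = (\<Sum>\<xi>\<in>UNIV. fourier f \<xi> * character x \<xi>)"
      using inv_fourier_fourier[of f x] by (simp add: inv_fourier_def character_commute[of _ x])
    then show "f x * cnj (g x) = (\<Sum>\<xi>\<in>UNIV. fourier f \<xi> * (character x \<xi> * cnj (g x)))"
      by (simp only: sum_distrib_right mult.assoc)
  qed
  also have "\<dots> = (\<Sum>\<xi>\<in>UNIV. fourier f \<xi> * (\<Sum>x\<in>UNIV. character x \<xi> * cnj (g x)))"
    by (subst sum.swap) (simp add: sum_distrib_left)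
  finally have "ip_space f g = (\<Sum>\<xi>\<in>UNIV. fourier f \<xi> * ((\<Sum>x\<in>UNIV. character x \<xi> * cnj (g x))
      / of_nat (CARD('q) ^ CARD('d))))"
    unfolding ip_space_def times_divide_eq_right sum_divide_distrib[symmetric] by simp
  moreover have "cnj (fourier g \<xi>) =
      (\<Sum>x\<in>UNIV. character x \<xi> * cnj (g x)) / of_nat (CARD('q) ^ CARD('d))" for \<xi>
    by (simp add: fourier_def mult.commute)
  ultimately show ?thesis
    by simp
qed

lemma fourier_zero: "fourier (\<lambda>x. 0) \<xi> = 0"
  by (simp add: fourier_def)

lemma fourier_add: "fourier (\<lambda>x. f x + g x) \<xi> = fourier f \<xi> + fourier g \<xi>"
  by (simp add: fourier_def ring_distribs sum.distrib add_divide_distrib)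

lemma fourier_fscale: "fourier (fscale c f) \<xi> = c * fourier f \<xi>"
  by (simp add: fourier_def fscale_def sum_distrib_left mult.assoc)

lemma fourier_translation: "fourier (translation t f) \<xi> = cnj (character \<xi> t) * fourier f \<xi>"
proof -
  have "(\<Sum>x\<in>UNIV. f (x - t) * cnj (character x \<xi>)) =
      (\<Sum>x\<in>UNIV. f x * cnj (character (x + t) \<xi>))"
    by (rule sum.reindex_bij_witness[of _ "\<lambda>x. x + t" "\<lambda>x. x - t"]) auto
  also have "\<dots> = cnj (character \<xi> t) * (\<Sum>x\<in>UNIV. f x * cnj (character x \<xi>))"
    by (simp add: character_commute[of _ \<xi>] character_add sum_distrib_left mult_ac)
  finally show ?thesis
    by (simp add: fourier_def translation_def)
qed

text \<open>
  The default simplification rule turns \<open>a\<^sup>t m\<close> into the row vector product \<open>m v* a\<close>, which would keep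
  the transform rules below, stated for \<open>a\<^sup>t m\<close>, from applying.
\<close>

declare transpose_matrix_vector [simp del]

lemma scalar_product_transpose:
  fixes a :: "'a::comm_semiring_1 ^ 'n ^ 'm"
  shows "scalar_product (transpose a *v m) x = scalar_product m (a *v x)"
  unfolding scalar_product_def matrix_vector_mult_def transpose_def
  by (simp add: sum_distrib_left sum_distrib_right mult_ac) (rule sum.swap)

lemma character_transpose: "character (transpose a *v m) x = character m (a *v x)"
  by (simp add: character_def scalar_product_transpose)

lemma bij_matrix_vector_mult:
  fixes a :: "'a::semiring_1 ^ 'n ^ 'n"
  assumes "invertible a"
  shows "bij ((*v) a)"
proof -
  obtain b where "a ** b = mat 1" "b ** a = mat 1"
    using assms by (auto simp: invertible_def)
  then show ?thesis
    by (intro o_bij[of "(*v) b"]) (auto simp: fun_eq_iff matrix_vector_mul_assoc)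
qed

lemma bij_transpose_mult:
  fixes a :: "'a::comm_semiring_1 ^ 'n ^ 'n"
  assumes "invertible a"
  shows "bij ((*v) (transpose a))"
proof (rule bij_matrix_vector_mult)
  show "invertible (transpose a)"
  proof -
    obtain b where b: "a ** b = mat 1" "b ** a = mat 1"
      using assms by (auto simp: invertible_def)
    have "transpose a ** transpose b = transpose (b ** a)"
      "transpose b ** transpose a = transpose (a ** b)"
      by (simp_all only: matrix_transpose_mul)
    then show ?thesis
      unfolding b transpose_mat invertible_def by blast
  qed
qed

lemma fourier_dilation:
  assumes "invertible a"
  shows "fourier (dilation a f) (transpose a *v m) = fourier f m"
proof -
  have "(\<Sum>x\<in>UNIV. f (a *v x) * cnj (character x (transpose a *v m))) =
      (\<Sum>x\<in>UNIV. f (a *v x) * cnj (character (a *v x) m))"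
    by (simp add: character_commute[of _ "transpose a *v m"] character_transpose
        character_commute[of m])
  also have "\<dots> = (\<Sum>x\<in>UNIV. f x * cnj (character x m))"
    using sum.reindex_bij_betw[OF bij_matrix_vector_mult[OF assms],
        of "\<lambda>x. f x * cnj (character x m)"] .
  finally show ?thesis
    by (simp add: fourier_def dilation_def)
qed

section \<open>Wavelets on the Fourier side\<close>

abbreviation wavelet :: "('q::prime_card, 'd::finite) space set \<Rightarrow>
    ('q mod_ring ^ 'd ^ 'd) \<times> ('q, 'd) space \<Rightarrow> ('q, 'd) space \<Rightarrow> complex" where
  "wavelet E \<equiv> wavelet_family (wavelet_gen E)"

text \<open>
  Evaluating at \<open>a\<^sup>t m\<close> rather than at \<open>m\<close> moves the support \<open>a\<^sup>t(E\<^sup>*)\<close> back to \<open>E\<^sup>*\<close>, independently of \<open>a\<close>.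
\<close>

lemma fourier_wavelet:
  assumes "invertible a"
  shows "fourier (wavelet E (a, l)) (transpose a *v m) =
    of_real (real (card E) powr (- 1 / 2)) * indicator (E - {0}) m * cnj (character m l)"
  using assms
  by (simp add: wavelet_family_def fourier_dilation fourier_translation wavelet_gen_def
      fourier_fscale fourier_inv_fourier mult_ac)

lemma fourier_wavelet_eq_0:
  assumes "invertible a" and "\<xi> \<notin> (\<lambda>x. transpose a *v x) ` (E - {0})"
  shows "fourier (wavelet E (a, l)) \<xi> = 0"
proof -
  obtain m where m: "\<xi> = transpose a *v m"
    using bij_transpose_mult[OF assms(1)] by (metis bij_pointE)
  with assms(2) have "m \<notin> E - {0}"
    by blast
  then show ?thesis
    using assms(1) by (simp add: m fourier_wavelet)
qed

text \<open>
  All terms of Parseval's sum are nonnegative, so a common point of the two supports would make it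
  positive.
\<close>

lemma disjoint_images_if_orthogonal:
  fixes E :: "('q::prime_card, 'd::finite) space set"
  assumes "E \<noteq> {}" and a: "invertible a" and b: "invertible b"
    and ip: "ip_space (wavelet E (a, 0)) (wavelet E (b, 0)) = 0"
  shows "(\<lambda>x. transpose a *v x) ` (E - {0}) \<inter> (\<lambda>x. transpose b *v x) ` (E - {0}) = {}"
    (is "?A \<inter> ?B = {}")
proof -
  define c where "c = real (card E) powr (- 1 / 2)"
  have "c > 0"
    using assms(1) by (simp add: c_def card_gt_0_iff)
  have ind: "fourier (wavelet E (a', 0)) \<xi> =
      of_real c * indicator ((\<lambda>x. transpose a' *v x) ` (E - {0})) \<xi>"
    if a': "invertible a'" for a' :: "'q mod_ring ^ 'd ^ 'd" and \<xi>
  proof (cases "\<xi> \<in> (\<lambda>x. transpose a' *v x) ` (E - {0})")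
    case True
    then obtain m where "m \<in> E - {0}" and m: "\<xi> = transpose a' *v m"
      by blast
    then show ?thesis
      using True a' by (simp add: fourier_wavelet c_def)
  next
    case False
    then show ?thesis
      using fourier_wavelet_eq_0[OF a' False] by simp
  qed
  have "0 = (\<Sum>\<xi>\<in>UNIV. of_real c * indicator ?A \<xi> * cnj (of_real c * indicator ?B \<xi>))"
    using ip by (simp only: parseval ind[OF a] ind[OF b])
  also have "\<dots> = (\<Sum>\<xi>\<in>?A \<inter> ?B. complex_of_real (c\<^sup>2))"
    by (rule sum.mono_neutral_cong_right) (auto simp: indicator_def power2_eq_square)
  finally show ?thesis
    using \<open>c > 0\<close> by simp
qed

text \<open>
  The factors \<open>cnj \<chi>\<^sub>l\<close> and \<open>\<chi>\<^sub>k\<close> of Parseval's sum come with the same positive constant; substituting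
  \<open>\<xi> = a\<^sup>t m\<close> leaves the sum over \<open>E\<^sup>*\<close>.
\<close>

lemma characters_orthogonal:
  fixes E :: "('q::prime_card, 'd::finite) space set"
  assumes "E \<noteq> {}" and a: "invertible a"
    and ip: "ip_space (wavelet E (a, l)) (wavelet E (a, k)) = 0"
  shows "ip_on (E - {0}) (character k) (character l) = 0"
proof -
  define c where "c = real (card E) powr (- 1 / 2)"
  have "c > 0"
    using assms(1) by (simp add: c_def card_gt_0_iff)
  have "0 = (\<Sum>m\<in>UNIV. fourier (wavelet E (a, l)) (transpose a *v m) *
      cnj (fourier (wavelet E (a, k)) (transpose a *v m)))"
    using ip sum.reindex_bij_betw[OF bij_transpose_mult[OF a],
        of "\<lambda>\<xi>. fourier (wavelet E (a, l)) \<xi> * cnj (fourier (wavelet E (a, k)) \<xi>)"]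
    by (simp add: parseval)
  also have "\<dots> = (\<Sum>m\<in>E - {0}. complex_of_real (c\<^sup>2) * (character m k * cnj (character m l)))"
    using a by (intro sum.mono_neutral_cong_right)
      (auto simp: fourier_wavelet power2_eq_square c_def)
  also have "\<dots> = complex_of_real (c\<^sup>2) * ip_on (E - {0}) (character k) (character l)"
    by (simp add: ip_on_def sum_distrib_left character_commute[of k] character_commute[of l])
  finally show ?thesis
    using \<open>c > 0\<close> by simp
qed

section \<open>Orthogonal families and spanning\<close>

lemma ip_on_restrict0 [simp]: "ip_on F (restrict0 F f) (restrict0 F g) = ip_on F f g"
  by (simp add: ip_on_def restrict0_def)

lemma ip_on_fscale_left: "ip_on F (fscale c f) g = c * ip_on F f g"
  by (simp add: ip_on_def fscale_def sum_distrib_left mult.assoc)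

lemma ip_on_sum_left: "ip_on F (\<Sum>v\<in>S. f v) g = (\<Sum>v\<in>S. ip_on F (f v) g)"
proof (induction S rule: infinite_finite_induct)
  case (insert v S)
  then show ?case
    by (simp add: ip_on_def ring_distribs sum.distrib)
qed (simp_all add: ip_on_def)

lemma orthogonal_imp_independent:
  assumes orth: "\<And>v w. v \<in> B \<Longrightarrow> w \<in> B \<Longrightarrow> v \<noteq> w \<Longrightarrow> ip_on F v w = 0"
    and nz: "\<And>v. v \<in> B \<Longrightarrow> ip_on F v v \<noteq> 0"
  shows "cfun.independent B"
  unfolding cfun.independent_explicit_module
proof (intro allI impI)
  fix S :: "('a \<Rightarrow> complex) set" and u w
  assume S: "finite S" "S \<subseteq> B" and sum: "(\<Sum>v\<in>S. fscale (u v) v) = 0" and w: "w \<in> S"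
  have "0 = ip_on F (\<Sum>v\<in>S. fscale (u v) v) w"
    by (simp add: sum) (simp add: ip_on_def)
  also have "\<dots> = (\<Sum>v\<in>S. u v * ip_on F v w)"
    by (simp add: ip_on_sum_left ip_on_fscale_left)
  also have "\<dots> = (\<Sum>v\<in>S. if v = w then u v * ip_on F v w else 0)"
    using orth S w by (intro sum.cong) auto
  also have "\<dots> = u w * ip_on F w w"
    using S w by simp
  finally show "u w = 0"
    using nz S w by auto
qed

lemma ip_on_character_self: "ip_on F (character l) (character l) = of_nat (card F)"
  by (simp add: ip_on_def)

lemma spectral_pairI:
  fixes F L :: "('q::prime_card, 'd::finite) space set"
  assumes "F \<noteq> {}"
    and orth: "\<And>l k. l \<in> L \<Longrightarrow> k \<in> L \<Longrightarrow> l \<noteq> k \<Longrightarrow> ip_on F (character l) (character k) = 0"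
    and span: "L2_on F \<subseteq> cfun.span ((\<lambda>l. restrict0 F (character l)) ` L)"
  shows "spectral_pair F L"
proof -
  let ?v = "\<lambda>l. restrict0 F (character l)"
  have nz: "ip_on F (?v l) (?v l) \<noteq> 0" for l
    using assms(1) by (simp add: ip_on_character_self)
  have "inj_on ?v L"
  proof (rule inj_onI, rule ccontr)
    fix l k
    assume "l \<in> L" "k \<in> L" and eq: "?v l = ?v k" and "l \<noteq> k"
    then have "ip_on F (?v l) (?v k) = 0"
      unfolding ip_on_restrict0 by (intro orth)
    then show False
      using nz[of l] by (simp only: eq)
  qed
  moreover have "cfun.independent (?v ` L)"
  proof (rule orthogonal_imp_independent[where F = F])
    fix v w
    assume "v \<in> ?v ` L" "w \<in> ?v ` L" "v \<noteq> w"
    then obtain l k where "v = ?v l" "w = ?v k" "l \<in> L" "k \<in> L" "l \<noteq> k"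
      by blast
    then show "ip_on F v w = 0"
      using orth by simp
  next
    fix v
    assume "v \<in> ?v ` L"
    then show "ip_on F v v \<noteq> 0"
      using nz by blast
  qed
  moreover have "cfun.span (?v ` L) = L2_on F"
  proof
    have "cfun.subspace (L2_on F)"
      by (rule cfun.subspaceI) (auto simp: L2_on_def fscale_def)
    then show "cfun.span (?v ` L) \<subseteq> L2_on F"
      by (intro cfun.span_minimal) (auto simp: L2_on_def restrict0_def)
  qed (rule span)
  ultimately show ?thesis
    using orth by (simp add: spectral_pair_def orthogonal_basis_def)
qed

text \<open>
  The map in question is additive and conjugate-homogeneous, so it is enough to treat the
  generators; by disjointness those with matrix \<open>b \<noteq> a\<close> have a transform that vanishes on \<open>a\<^sup>t(E\<^sup>*)\<close>.
  The conjugation is there to produce \<open>\<chi>\<^sub>l\<close> instead of its conjugate.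
\<close>

lemma pulled_back_spectrum_in_span:
  fixes E L :: "('q::prime_card, 'd::finite) space set"
  assumes inv: "\<A> \<subseteq> {a. invertible a}"
    and disj: "disjoint_family_on (\<lambda>a. (\<lambda>x. transpose a *v x) ` (E - {0})) \<A>"
    and a: "a \<in> \<A>"
    and f: "f \<in> cfun.span (wavelet E ` (\<A> \<times> L))"
  shows "restrict0 (E - {0}) (\<lambda>m. cnj (fourier f (transpose a *v m))) \<in>
    cfun.span ((\<lambda>l. restrict0 (E - {0}) (character l)) ` L)"
    (is "?T f \<in> cfun.span ?X")
  using f
proof (induction rule: cfun.span_induct)
  case base
  have "?T 0 = 0"
    by (simp add: restrict0_def fourier_zero fun_eq_iff)
  moreover have "?T (g + h) = ?T g + ?T h" for g h
    by (simp add: restrict0_def fourier_add fun_eq_iff)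
  moreover have "?T (fscale c g) = fscale (cnj c) (?T g)" for c g
    unfolding restrict0_def fourier_fscale by (simp add: fscale_def fun_eq_iff)
  ultimately show ?case
    by (intro cfun.subspaceI)
      (simp_all only: mem_Collect_eq cfun.span_zero cfun.span_add cfun.span_scale)
next
  case (step g)
  then obtain b l where g: "g = wavelet E (b, l)" and b: "b \<in> \<A>" and l: "l \<in> L"
    by blast
  show ?case
  proof (cases "b = a")
    case True
    have "?T g = fscale (of_real (real (card E) powr (- 1 / 2)))
        (restrict0 (E - {0}) (character l))"
      using inv a
      by (auto simp: g True restrict0_def fscale_def fun_eq_iff fourier_wavelet
          character_commute[of l])
    then show ?thesis
      using l by (simp add: cfun.span_scale cfun.span_base)
  next
    case False
    have "fourier g (transpose a *v m) = 0" if "m \<in> E - {0}" for m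
    proof -
      have "transpose a *v m \<notin> (\<lambda>x. transpose b *v x) ` (E - {0})"
        using disjoint_family_onD[OF disj b a False] that by blast
      then show ?thesis
        using inv b by (auto simp: g intro!: fourier_wavelet_eq_0)
    qed
    then have "?T g = 0"
      by (simp add: restrict0_def fun_eq_iff)
    then show ?thesis
      by (simp only: cfun.span_zero)
  qed
qed

lemma inv_fourier_in_PW: "g \<in> L2_on Y \<Longrightarrow> inv_fourier g \<in> PW Y"
  by (simp add: PW_def L2_on_def fourier_inv_fourier)

text \<open>
  A function \<open>g\<close> on \<open>E\<^sup>*\<close> is transplanted to \<open>a\<^sup>t(E\<^sup>*)\<close> on the Fourier side. The result vanishes at \<open>0\<close>
  because \<open>a\<^sup>t\<close> fixes \<open>0\<close> and \<open>0 \<notin> E\<^sup>*\<close>.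
\<close>

lemma L2_on_pulled_back_spectrum:
  fixes E :: "('q::prime_card, 'd::finite) space set" and a :: "'q mod_ring ^ 'd ^ 'd"
  assumes a: "invertible a" and g: "g \<in> L2_on (E - {0})"
  obtains f where "f \<in> PW (UNIV - {0})"
    and "restrict0 (E - {0}) (\<lambda>m. cnj (fourier f (transpose a *v m))) = g"
proof -
  let ?t = "(*v) (transpose a)"
  define h where "h = (\<lambda>\<xi>. cnj (g (the_inv ?t \<xi>)))"
  have bij: "bij ?t"
    by (rule bij_transpose_mult[OF a])
  then have inv_t: "the_inv ?t (transpose a *v m) = m" for m
    by (simp add: bij_is_inj the_inv_f_f)
  have "the_inv ?t 0 = 0"
    using inv_t[of 0] by simp
  then have "h \<in> L2_on (UNIV - {0})"
    using g by (simp add: h_def L2_on_def)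
  moreover have "restrict0 (E - {0}) (\<lambda>m. cnj (fourier (inv_fourier h) (transpose a *v m))) = g"
    using g by (auto simp: fun_eq_iff restrict0_def fourier_inv_fourier h_def inv_t L2_on_def)
  ultimately show ?thesis
    using that inv_fourier_in_PW by blast
qed

text \<open>
  Completeness is also what provides a matrix to work with: an empty family spans only \<open>0\<close>, whereas a
  single nonzero frequency gives a nonzero element of the Paley--Wiener space.
\<close>

lemma PW_nontrivial:
  fixes \<xi> :: "('q::prime_card, 'd::finite) space"
  assumes "\<xi> \<in> Y"
  shows "PW Y \<noteq> {0}"
proof
  assume trivial: "PW Y = {0}"
  have "inv_fourier (indicator {\<xi>}) \<in> PW Y"
    using assms by (intro inv_fourier_in_PW) (auto simp: L2_on_def indicator_def)
  then have "fourier (inv_fourier (indicator {\<xi>})) \<xi> = 0"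
    by (simp add: trivial fourier_zero zero_fun_def)
  then show False
    by (simp add: fourier_inv_fourier)
qed

section \<open>Orthogonal wavelet bases yield spectral pairs\<close>

theorem theorem2p10:
  fixes E L :: "('q::prime_card mod_ring ^ 'd::finite) set"
    and \<A> :: "('q mod_ring ^ 'd ^ 'd) set"
  assumes "odd CARD('q)"
    and "1 < card E" and "card E < CARD('q) ^ CARD('d)"
    and "\<A> \<subseteq> {a. invertible a}"
    and "orthogonal_basis ip_space (\<A> \<times> L) (wavelet_family (wavelet_gen E)) (PW (UNIV - {0}))"
    and "0 \<in> L"
  shows "disjoint_family_on (\<lambda>a. (\<lambda>x. transpose a *v x) ` (E - {0})) \<A> \<and>
    spectral_pair (E - {0}) L"
proof
  have orth: "ip_space (wavelet E (a, l)) (wavelet E (b, k)) = 0"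
    if "a \<in> \<A>" "b \<in> \<A>" "l \<in> L" "k \<in> L" "(a, l) \<noteq> (b, k)" for a b l k
    using assms(5) that unfolding orthogonal_basis_def by blast
  have span: "cfun.span (wavelet E ` (\<A> \<times> L)) = PW (UNIV - {0})"
    using assms(5) by (simp add: orthogonal_basis_def)
  have "E \<noteq> {}"
    using assms(2) by auto
  have "\<not> E \<subseteq> {0}"
    using card_mono[of "{0}" E] assms(2) by auto
  then obtain \<xi> where \<xi>: "\<xi> \<in> E - {0}"
    by blast
  show disj: "disjoint_family_on (\<lambda>a. (\<lambda>x. transpose a *v x) ` (E - {0})) \<A>"
    unfolding disjoint_family_on_def
    using assms(4,6) \<open>E \<noteq> {}\<close> by (intro ballI impI disjoint_images_if_orthogonal orth) auto
  have "\<A> \<noteq> {}"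
  proof
    assume "\<A> = {}"
    then have "PW (UNIV - {0} :: ('q, 'd) space set) = {0}"
      by (simp flip: span)
    then show False
      using PW_nontrivial[of \<xi> "UNIV - {0}"] \<xi> by blast
  qed
  then obtain a where a: "a \<in> \<A>"
    by blast
  with assms(4) have "invertible a"
    by blast
  show "spectral_pair (E - {0}) L"
  proof (rule spectral_pairI)
    show "E - {0} \<noteq> {}"
      using \<xi> by blast
    show "ip_on (E - {0}) (character l) (character k) = 0" if "l \<in> L" "k \<in> L" "l \<noteq> k" for l k
      using that a by (intro characters_orthogonal[OF \<open>E \<noteq> {}\<close> \<open>invertible a\<close>] orth) auto
    show "L2_on (E - {0}) \<subseteq> cfun.span ((\<lambda>l. restrict0 (E - {0}) (character l)) ` L)"
    proof
      fix g :: "('q, 'd) space \<Rightarrow> complex"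
      assume "g \<in> L2_on (E - {0})"
      then obtain f where "f \<in> PW (UNIV - {0})"
        and "restrict0 (E - {0}) (\<lambda>m. cnj (fourier f (transpose a *v m))) = g"
        using L2_on_pulled_back_spectrum[OF \<open>invertible a\<close>] by blast
      then show "g \<in> cfun.span ((\<lambda>l. restrict0 (E - {0}) (character l)) ` L)"
        using pulled_back_spectrum_in_span[OF assms(4) disj a, of f L] span by simp
    qed
  qed
qed

end
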